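(* Let $\mathbb G$, $\mathbb H$ be graphs such that $\mathbb H$ has at least one vertex. Then there exists a surjective locally surjective homomorphism from $\mathbb G$ onto $\mathbb H$ if and only if there is a surjective $p$-morphism from $\operatorname{Pos}(\mathbb G)$ onto $\operatorname{Pos}(\mathbb H)$.
   Context: A graph $\mathbb G$ consists of a vertex set $V^{\mathbb G}$ and an edge set $E^{\mathbb G}$ of two-element subsets of $V^{\mathbb G}$; the edge $\{u,v\}$ is written $uv$. A map $g\colon V^{\mathbb G}\to V^{\mathbb H}$ is a locally surjective homomorphism if (HP) $uv\in E^{\mathbb G}$ implies $g(u)g(v)\in E^{\mathbb H}$, and (BP) for all $u\in V^{\mathbb G}$, $w\in V^{\mathbb H}$ with $g(u)w\in E^{\mathbb H}$ there is $v\in V^{\mathbb G}$ with $uv\in E^{\mathbb G}$ and $g(v)=w$. For posets $\mathbb P,\mathbb Q$ (carriers $X^{\mathbb P},X^{\mathbb Q}$), a $p$-morphism is a map $h\colon X^{\mathbb P}\to X^{\mathbb Q}$ such that (HP) $x\leq^{\mathbb P}y$ implies $h(x)\leq^{\mathbb Q}h(y)$, and (BP) whenever $h(x)\leq^{\mathbb Q}y$ there is $z$ with $x\leq^{\mathbb P}z$ and $h(z)=y$. Construction of $\operatorname{Pos}(\mathbb G)$: its carrier is $V\cup V_a\cup V_b\cup E_1\cup E_2\cup\{\top_1,\top_2,\infty_a,\infty_b\}$, where $V=V^{\mathbb G}$, $V_a=\{v_a:v\in V\}$ and $V_b=\{v_b:v\in V\}$ are disjoint copies of $V$, $E_1=\{e_1:e\in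 E^{\mathbb G}\}$ and $E_2=\{e_2:e\in E^{\mathbb G}\}$ are disjoint copies of $E^{\mathbb G}$, and $\top_1,\top_2,\infty_a,\infty_b$ are four new elements. The order is the reflexive–transitive closure of the following covering relation: $v\prec v_a$, $v\prec v_b$, $v_a\prec\infty_a$, $v_b\prec\infty_b$ for every $v\in V$; $e_1\prec\top_1$, $e_1\prec\top_2$, $e_2\prec\top_1$, $e_2\prec\top_2$ for every $e\in E^{\mathbb G}$; $v_a\prec\top_1,\ v_a\prec\top_2,\ v_b\prec\top_1,\ v_b\prec\top_2$ for every isolated vertex $v$; and for every edge $e=uv$, covers $u_a\prec e_i$, $v_b\prec e_i$, $u_b\prec e_j$, $v_a\prec e_j$ where $\{i,j\}=\{1,2\}$ (for each edge one of its two copies is chosen, arbitrarily, to lie above $u_a$ and $v_b$, and the other lies above $u_b$ and $v_a$). *)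

theory Defs
  imports Main
begin

record 'v graph =
  verts :: "'v set"
  edges :: "'v set set"

definition simple_graph :: "'v graph \<Rightarrow> bool" where
  "simple_graph G \<longleftrightarrow> (\<forall>e\<in>edges G. e \<subseteq> verts G \<and> card e = 2)"

definition isolated :: "'v graph \<Rightarrow> 'v \<Rightarrow> bool" where
  "isolated G v \<longleftrightarrow> v \<in> verts G \<and> (\<forall>u. {v, u} \<notin> edges G)"

definition locally_surjective_hom :: "'v graph \<Rightarrow> 'w graph \<Rightarrow> ('v \<Rightarrow> 'w) \<Rightarrow> bool" where
  "locally_surjective_hom G H g \<longleftrightarrow>
     g ` verts G \<subseteq> verts H \<and>
     (\<forall>u v. {u, v} \<in> edges G \<longrightarrow> {g u, g v} \<in> edges H) \<and>
     (\<forall>u\<in>verts G. \<forall>w\<in>verts H. {g u, w} \<in> edges H \<longrightarrow>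
        (\<exists>v\<in>verts G. {u, v} \<in> edges G \<and> g v = w))"

definition p_morphism :: "'x set \<Rightarrow> 'x rel \<Rightarrow> 'y set \<Rightarrow> 'y rel \<Rightarrow> ('x \<Rightarrow> 'y) \<Rightarrow> bool" where
  "p_morphism X r Y s h \<longleftrightarrow>
     h ` X \<subseteq> Y \<and>
     (\<forall>x\<in>X. \<forall>y\<in>X. (x, y) \<in> r \<longrightarrow> (h x, h y) \<in> s) \<and>
     (\<forall>x\<in>X. \<forall>y\<in>Y. (h x, y) \<in> s \<longrightarrow> (\<exists>z\<in>X. (x, z) \<in> r \<and> h z = y))"

datatype 'v pos_elem =
    Vert 'v | VertA 'v | VertB 'v
  | Edge1 "'v set" | Edge2 "'v set"
  | Top1 | Top2 | InfA | InfB

definition pos_carrier :: "'v graph \<Rightarrow> 'v pos_elem set" where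
  "pos_carrier G =
     Vert ` verts G \<union> VertA ` verts G \<union> VertB ` verts G \<union>
     Edge1 ` edges G \<union> Edge2 ` edges G \<union> {Top1, Top2, InfA, InfB}"

text \<open>
  The arbitrary choice made at every edge is recorded by a function \<open>c\<close> selecting an endpoint:
  for \<open>e = uv\<close> with \<open>c e = u\<close>, the copy \<open>e\<^sub>1\<close> lies above \<open>u\<^sub>a\<close> and \<open>v\<^sub>b\<close>, and \<open>e\<^sub>2\<close> lies above \<open>u\<^sub>b\<close>
  and \<open>v\<^sub>a\<close>. The opposite choice for \<open>e\<close> is \<open>c e = v\<close>, so these functions represent all
  possible choices.
\<close>

definition endpoint_choice :: "'v graph \<Rightarrow> ('v set \<Rightarrow> 'v) \<Rightarrow> bool" where
  "endpoint_choice G c \<longleftrightarrow> (\<forall>e\<in>edges G. c e \<in> e)"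

inductive_set pos_cover :: "'v graph \<Rightarrow> ('v set \<Rightarrow> 'v) \<Rightarrow> 'v pos_elem rel"
  for G :: "'v graph" and c :: "'v set \<Rightarrow> 'v" where
  "v \<in> verts G \<Longrightarrow> (Vert v, VertA v) \<in> pos_cover G c"
| "v \<in> verts G \<Longrightarrow> (Vert v, VertB v) \<in> pos_cover G c"
| "v \<in> verts G \<Longrightarrow> (VertA v, InfA) \<in> pos_cover G c"
| "v \<in> verts G \<Longrightarrow> (VertB v, InfB) \<in> pos_cover G c"
| "\<lbrakk>e \<in> edges G; t \<in> {Top1, Top2}\<rbrakk> \<Longrightarrow> (Edge1 e, t) \<in> pos_cover G c"
| "\<lbrakk>e \<in> edges G; t \<in> {Top1, Top2}\<rbrakk> \<Longrightarrow> (Edge2 e, t) \<in> pos_cover G c"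
| "\<lbrakk>isolated G v; t \<in> {Top1, Top2}\<rbrakk> \<Longrightarrow> (VertA v, t) \<in> pos_cover G c"
| "\<lbrakk>isolated G v; t \<in> {Top1, Top2}\<rbrakk> \<Longrightarrow> (VertB v, t) \<in> pos_cover G c"
| "\<lbrakk>{u, v} \<in> edges G; c {u, v} = u\<rbrakk> \<Longrightarrow> (VertA u, Edge1 {u, v}) \<in> pos_cover G c"
| "\<lbrakk>{u, v} \<in> edges G; c {u, v} = u\<rbrakk> \<Longrightarrow> (VertB v, Edge1 {u, v}) \<in> pos_cover G c"
| "\<lbrakk>{u, v} \<in> edges G; c {u, v} = u\<rbrakk> \<Longrightarrow> (VertB u, Edge2 {u, v}) \<in> pos_cover G c"
| "\<lbrakk>{u, v} \<in> edges G; c {u, v} = u\<rbrakk> \<Longrightarrow> (VertA v, Edge2 {u, v}) \<in> pos_cover G c"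

definition pos_order :: "'v graph \<Rightarrow> ('v set \<Rightarrow> 'v) \<Rightarrow> 'v pos_elem rel" where
  "pos_order G c = Restr ((pos_cover G c)\<^sup>*) (pos_carrier G)"

lemma pos_cover_carrier:
  assumes "simple_graph G" "(x, y) \<in> pos_cover G c"
  shows "x \<in> pos_carrier G \<and> y \<in> pos_carrier G"
  using assms(2,1)
  by cases (auto simp: pos_carrier_def simple_graph_def isolated_def)

fun pos_rank :: "'v pos_elem \<Rightarrow> nat" where
  "pos_rank (Vert v) = 0"
| "pos_rank (VertA v) = 1"
| "pos_rank (VertB v) = 1"
| "pos_rank (Edge1 e) = 2"
| "pos_rank (Edge2 e) = 2"
| "pos_rank _ = 3"

lemma pos_cover_rank: "(x, y) \<in> pos_cover G c \<Longrightarrow> pos_rank x < pos_rank y"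
  by (induction rule: pos_cover.induct) auto

lemma pos_cover_rtrancl_rank:
  "(x, y) \<in> (pos_cover G c)\<^sup>* \<Longrightarrow> x = y \<or> pos_rank x < pos_rank y"
  by (induction rule: rtrancl_induct) (auto dest: pos_cover_rank)

lemma pos_order_partial_order: "partial_order_on (pos_carrier G) (pos_order G c)"
proof -
  have "trans (pos_order G c)"
    unfolding pos_order_def by (rule transI) (auto intro: rtrancl_trans)
  moreover have "antisym (pos_order G c)"
    unfolding pos_order_def by (rule antisymI) (auto dest!: pos_cover_rtrancl_rank)
  ultimately show ?thesis
    unfolding partial_order_on_def preorder_on_def
    by (auto simp: refl_on_def pos_order_def)
qed

end

theory Submission
  imports Defs
begin

text \<open>
  In \<open>Pos(G)\<close> the two copies of an edge \<open>uv\<close> correspond to its two orientations: the copy above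
  \<open>u\<^sub>a\<close> and \<open>v\<^sub>b\<close> is the arc from \<open>u\<close> to \<open>v\<close>. Hence a locally surjective homomorphism induces
  a map of posets by acting on vertices and arcs.

  Conversely, a p-morphism \<open>h\<close> maps the set of maximal elements above \<open>x\<close> onto the set of maximal
  elements above \<open>h x\<close>. If \<open>h\<close> is surjective, it permutes the four maximal elements and therefore
  preserves the number of maximal elements above a point, which is 4 on \<open>V\<close>, 3 on \<open>V\<^sub>a\<close> and \<open>V\<^sub>b\<close>,
  2 on edges and 1 on maximal elements. So \<open>h\<close> preserves these layers and restricts to a map
  \<open>g\<close> on vertices. It may exchange the roles of \<open>a\<close> and \<open>b\<close>, which only reverses all arcs.
\<close>

text \<open>The side \<open>True\<close> stands for the index \<open>a\<close>, the side \<open>False\<close> for \<open>b\<close>.\<close>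

definition side :: "bool \<Rightarrow> 'v \<Rightarrow> 'v pos_elem" where
  "side s v = (if s then VertA v else VertB v)"

definition infty :: "bool \<Rightarrow> 'v pos_elem" where
  "infty s = (if s then InfA else InfB)"

text \<open>The copy of the edge \<open>uv\<close> above \<open>side s u\<close> and \<open>side (\<not> s) v\<close>.\<close>

definition arc :: "('v set \<Rightarrow> 'v) \<Rightarrow> bool \<Rightarrow> 'v \<Rightarrow> 'v \<Rightarrow> 'v pos_elem" where
  "arc c s u v = (if (c {u, v} = u) = s then Edge1 {u, v} else Edge2 {u, v})"

lemma side_eq_iff [simp]: "side s u = side t v \<longleftrightarrow> s = t \<and> u = v"
  by (auto simp: side_def)

lemma infty_eq_iff [simp]: "infty s = infty t \<longleftrightarrow> s = t"
  by (auto simp: infty_def)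

lemma pos_elem_distinct [simp]:
  "Vert u \<noteq> side s v" "side s v \<noteq> Vert u"
  "Vert u \<noteq> infty s" "infty s \<noteq> Vert u"
  "Vert u \<noteq> arc c s v w" "arc c s v w \<noteq> Vert u"
  "Top1 \<noteq> side s v" "side s v \<noteq> Top1" "Top2 \<noteq> side s v" "side s v \<noteq> Top2"
  "Top1 \<noteq> infty s" "infty s \<noteq> Top1" "Top2 \<noteq> infty s" "infty s \<noteq> Top2"
  "Top1 \<noteq> arc c s v w" "arc c s v w \<noteq> Top1" "Top2 \<noteq> arc c s v w" "arc c s v w \<noteq> Top2"
  "side s v \<noteq> infty t" "infty t \<noteq> side s v"
  "side t u \<noteq> arc c s v w" "arc c s v w \<noteq> side t u"
  "infty t \<noteq> arc c s v w" "arc c s v w \<noteq> infty t"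
  by (auto simp: side_def infty_def arc_def)

section \<open>Copies of edges as arcs of a single graph\<close>

locale pos_graph =
  fixes G :: "'v graph" and c :: "'v set \<Rightarrow> 'v"
  assumes simple: "simple_graph G" and choice: "endpoint_choice G c"
begin

lemma edge_verts: "{u, v} \<in> edges G \<Longrightarrow> u \<in> verts G \<and> v \<in> verts G \<and> u \<noteq> v"
  using simple by (fastforce simp: simple_graph_def)

lemma edge_choice: "{u, v} \<in> edges G \<Longrightarrow> c {u, v} = u \<or> c {u, v} = v"
  using choice by (fastforce simp: endpoint_choice_def)

lemma edge_obtain:
  assumes "e \<in> edges G"
  obtains v where "e = {c e, v}"
proof -
  from assms simple obtain x y where "e = {x, y}"
    by (auto simp: simple_graph_def card_2_iff)
  moreover from assms choice have "c e \<in> e"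
    by (auto simp: endpoint_choice_def)
  ultimately show ?thesis
    using that by (metis insertE insert_commute singletonD)
qed

text \<open>The chosen endpoint is exactly one of \<open>u\<close> and \<open>v\<close>, so
  exchanging the endpoints negates the test in \<open>arc\<close>, and changing the side negates it
  back.\<close>

lemma arc_flip: "{u, v} \<in> edges G \<Longrightarrow> arc c s u v = arc c (\<not> s) v u"
  using edge_choice[of u v] edge_verts[of u v] by (auto simp: arc_def insert_commute)

text \<open>For a fixed side, the two orientations of an edge are its two different copies. A copy
  and a side thus recover the orientation, which later identifies endpoints from order
  relations.\<close>

lemma arc_inject:
  assumes "arc c s u v = arc c s u' v'" and "{u, v} \<in> edges G"
  shows "u = u' \<and> v = v'"
proof -
  from assms(1) have "{u, v} = {u', v'}"
    by (auto simp: arc_def split: if_splits)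
  then show ?thesis
    using assms edge_choice[of u v] edge_verts[of u v]
    by (auto simp: arc_def doubleton_eq_iff insert_commute split: if_splits)
qed

lemma Edge1_arc:
  assumes "e \<in> edges G"
  obtains u v where "{u, v} \<in> edges G" "Edge1 e = arc c s u v"
proof -
  obtain v where v: "e = {c e, v}" using edge_obtain[OF assms] .
  with assms have e: "{c e, v} \<in> edges G" "{v, c e} \<in> edges G"
    by (simp_all add: insert_commute)
  have eq: "Edge1 e = arc c True (c e) v"
    using v by (simp add: arc_def)
  show ?thesis
  proof (cases "s = True")
    case True
    with that[OF e(1)] eq show ?thesis by simp
  next
    case False
    with that[OF e(2)] eq arc_flip[OF e(1), of True] show ?thesis by simp
  qed
qed

lemma Edge2_arc:
  assumes "e \<in> edges G"
  obtains u v where "{u, v} \<in> edges G" "Edge2 e = arc c s u v"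
proof -
  obtain v where v: "e = {c e, v}" using edge_obtain[OF assms] .
  with assms have e: "{c e, v} \<in> edges G" "{v, c e} \<in> edges G"
    by (simp_all add: insert_commute)
  have eq: "Edge2 e = arc c False (c e) v"
    using v by (simp add: arc_def)
  show ?thesis
  proof (cases "s = False")
    case True
    with that[OF e(1)] eq show ?thesis by simp
  next
    case False
    with that[OF e(2)] eq arc_flip[OF e(1), of False] show ?thesis by simp
  qed
qed

lemma side_in_carrier [simp]: "side s v \<in> pos_carrier G \<longleftrightarrow> v \<in> verts G"
  by (auto simp: side_def pos_carrier_def)

lemma Vert_in_carrier [simp]: "Vert v \<in> pos_carrier G \<longleftrightarrow> v \<in> verts G"
  by (auto simp: pos_carrier_def)

lemma arc_in_carrier [simp]: "arc c s u v \<in> pos_carrier G \<longleftrightarrow> {u, v} \<in> edges G"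
  by (auto simp: arc_def pos_carrier_def)

lemma max_in_carrier [simp]:
  "Top1 \<in> pos_carrier G" "Top2 \<in> pos_carrier G" "infty s \<in> pos_carrier G"
  by (auto simp: infty_def pos_carrier_def)

text \<open>Each copy of an edge is an arc for either side, in opposite orientations. The side
  \<open>s'\<close> is left to the caller, who picks the one matching the arcs at hand.\<close>

lemma carrier_cases [consumes 1, case_names Vert side arc Top1 Top2 infty]:
  assumes "x \<in> pos_carrier G"
  obtains v where "v \<in> verts G" "x = Vert v"
  | s v where "v \<in> verts G" "x = side s v"
  | u v where "{u, v} \<in> edges G" "x = arc c s' u v"
  | "x = Top1" | "x = Top2"
  | s where "x = infty s"
proof (cases x)
  case (Vert v)
  with assms that(1) show ?thesis by (auto simp: pos_carrier_def)
next
  case (VertA v)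
  with assms that(2)[of v True] show ?thesis by (auto simp: pos_carrier_def side_def)
next
  case (VertB v)
  with assms that(2)[of v False] show ?thesis by (auto simp: pos_carrier_def side_def)
next
  case (Edge1 e)
  with assms have "e \<in> edges G" by (auto simp: pos_carrier_def)
  then obtain u v where "{u, v} \<in> edges G" "Edge1 e = arc c s' u v"
    by (rule Edge1_arc)
  with Edge1 that(3) show ?thesis by simp
next
  case (Edge2 e)
  with assms have "e \<in> edges G" by (auto simp: pos_carrier_def)
  then obtain u v where "{u, v} \<in> edges G" "Edge2 e = arc c s' u v"
    by (rule Edge2_arc)
  with Edge2 that(3) show ?thesis by simp
next
  case InfA
  with that(6)[of True] show ?thesis by (simp add: infty_def)
next
  case InfB
  with that(6)[of False] show ?thesis by (simp add: infty_def)
qed (use that in auto)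

section \<open>The covering relation in terms of sides and arcs\<close>

lemma cover_Vert: "(Vert v, y) \<in> pos_cover G c \<longleftrightarrow> v \<in> verts G \<and> (\<exists>s. y = side s v)"
  by (auto simp: side_def elim: pos_cover.cases intro: pos_cover.intros)

text \<open>The four edge rules of \<open>pos_cover\<close> differ only in the index and in whether
  the vertex is the chosen endpoint. \<open>arc\<close> absorbs both, so later arguments treat the
  two indices uniformly.\<close>

lemma cover_side:
  "(side s v, y) \<in> pos_cover G c \<longleftrightarrow>
     v \<in> verts G \<and> y = infty s \<or> isolated G v \<and> y \<in> {Top1, Top2} \<or>
     (\<exists>u. {v, u} \<in> edges G \<and> y = arc c s v u)" (is "?L \<longleftrightarrow> ?R")
proof
  have R: ?R if "{v, u} \<in> edges G" "y = arc c s v u" for u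
    using that by blast
  assume ?L
  then show ?R
  proof cases
    case (9 u w)
    then have "s" "u = v" by (simp_all add: side_def split: if_splits)
    with 9 show ?thesis by (intro R[of w]) (simp_all add: arc_def)
  next
    case (10 u w)
    then have "\<not> s" "w = v" by (simp_all add: side_def split: if_splits)
    with 10 edge_verts[of u w] show ?thesis
      by (intro R[of u]) (simp_all add: arc_def insert_commute)
  next
    case (11 u w)
    then have "\<not> s" "u = v" by (simp_all add: side_def split: if_splits)
    with 11 show ?thesis by (intro R[of w]) (simp_all add: arc_def)
  next
    case (12 u w)
    then have "s" "w = v" by (simp_all add: side_def split: if_splits)
    with 12 edge_verts[of u w] show ?thesis
      by (intro R[of u]) (simp_all add: arc_def insert_commute)
  qed (simp_all add: side_def infty_def split: if_splits)
next
  have arc: "(side s v, arc c s v u) \<in> pos_cover G c" if e: "{v, u} \<in> edges G" for u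
  \<comment> \<open>The edge rules are phrased by the chosen endpoint: rules 9 and 11 apply if it is
    \<open>v\<close>, rules 10 and 12 if it is \<open>u\<close>.\<close>
  proof (cases "c {v, u} = v")
    case True
    with e show ?thesis
      using pos_cover.intros(9,11)[of v u G c] by (simp add: side_def arc_def)
  next
    case False
    with e edge_choice[OF e] have "{u, v} \<in> edges G" "c {u, v} = u"
      by (simp_all add: insert_commute)
    with False show ?thesis
      using pos_cover.intros(10,12)[of u v G c] by (simp add: side_def arc_def insert_commute)
  qed
  assume ?R
  then show ?L
  proof (elim disjE conjE exE)
    show ?L if "v \<in> verts G" "y = infty s"
      using that by (simp add: side_def infty_def pos_cover.intros)
    show ?L if "isolated G v" "y \<in> {Top1, Top2}"
      using that by (simp add: side_def pos_cover.intros)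
    show ?L if "{v, u} \<in> edges G" "y = arc c s v u" for u
      using that arc by simp
  qed
qed

lemma cover_arc:
  assumes "{u, v} \<in> edges G"
  shows "(arc c s u v, y) \<in> pos_cover G c \<longleftrightarrow> y \<in> {Top1, Top2}" (is "?L \<longleftrightarrow> ?R")
proof
  assume ?L
  then show ?R by cases (simp_all add: arc_def split: if_splits)
next
  assume ?R
  with assms show ?L by (simp add: arc_def pos_cover.intros)
qed

lemma cover_max [simp]:
  "(Top1, y) \<notin> pos_cover G c" "(Top2, y) \<notin> pos_cover G c" "(infty s, y) \<notin> pos_cover G c"
  by (rule notI, erule pos_cover.cases; simp add: infty_def split: if_splits)+

section \<open>Principal up-sets, computed from the top layer downwards\<close>

lemma le_unfold:
  assumes "x \<in> pos_carrier G"
  shows "(x, y) \<in> pos_order G c \<longleftrightarrow>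
           y = x \<or> (\<exists>z. (x, z) \<in> pos_cover G c \<and> (z, y) \<in> pos_order G c)" (is "?L \<longleftrightarrow> ?R")
proof
  assume L: ?L
  then have "(x, y) \<in> (pos_cover G c)\<^sup>*" "y \<in> pos_carrier G"
    by (auto simp: pos_order_def)
  then show ?R
    using pos_cover_carrier[OF simple] by (cases rule: converse_rtranclE) (auto simp: pos_order_def)
next
  assume ?R
  with assms show ?L
    by (auto simp: pos_order_def intro: converse_rtrancl_into_rtrancl)
qed

lemma le_max [simp]:
  "(Top1, y) \<in> pos_order G c \<longleftrightarrow> y = Top1"
  "(Top2, y) \<in> pos_order G c \<longleftrightarrow> y = Top2"
  "(infty s, y) \<in> pos_order G c \<longleftrightarrow> y = infty s"
  by (subst le_unfold; simp)+

lemma le_arc: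
  "{u, v} \<in> edges G \<Longrightarrow> (arc c s u v, y) \<in> pos_order G c \<longleftrightarrow> y \<in> {arc c s u v, Top1, Top2}"
  by (subst le_unfold) (auto simp: cover_arc)

text \<open>A vertex that is not isolated reaches the two tops through an incident edge.\<close>

lemma le_side:
  assumes "v \<in> verts G"
  shows "(side s v, y) \<in> pos_order G c \<longleftrightarrow>
     y \<in> {side s v, infty s, Top1, Top2} \<or> (\<exists>u. {v, u} \<in> edges G \<and> y = arc c s v u)"
    (is "?L \<longleftrightarrow> ?R")
proof -
  have "?L \<longleftrightarrow> y = side s v \<or> (\<exists>z. (side s v, z) \<in> pos_cover G c \<and> (z, y) \<in> pos_order G c)"
    using assms by (intro le_unfold) simp
  also have "\<dots> \<longleftrightarrow> y = side s v \<or> y = infty s \<or> isolated G v \<and> y \<in> {Top1, Top2} \<or>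
      (\<exists>u. {v, u} \<in> edges G \<and> y \<in> {arc c s v u, Top1, Top2})"
    using assms by (auto simp: cover_side le_arc)
  also have "\<dots> \<longleftrightarrow> ?R"
    using assms by (auto simp: isolated_def)
  finally show ?thesis .
qed

lemma le_Vert:
  "v \<in> verts G \<Longrightarrow> (Vert v, y) \<in> pos_order G c \<longleftrightarrow>
     y = Vert v \<or> (\<exists>s. (side s v, y) \<in> pos_order G c)"
  by (subst le_unfold) (auto simp: cover_Vert)

end

section \<open>Maximal elements above a point\<close>

fun maxima :: "'v pos_elem \<Rightarrow> 'v pos_elem set" where
  "maxima (Vert v) = {Top1, Top2, InfA, InfB}"
| "maxima (VertA v) = {Top1, Top2, InfA}"
| "maxima (VertB v) = {Top1, Top2, InfB}"
| "maxima (Edge1 e) = {Top1, Top2}"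
| "maxima (Edge2 e) = {Top1, Top2}"
| "maxima x = {x}"

lemma maxima_simps [simp]:
  "maxima (side s v) = {Top1, Top2, infty s}"
  "maxima (arc c s u v) = {Top1, Top2}"
  "maxima (infty s) = {infty s}"
  by (auto simp: side_def arc_def infty_def)

abbreviation all_maxima :: "'v pos_elem set" where
  "all_maxima \<equiv> {Top1, Top2, InfA, InfB}"

lemma all_maxima_infty: "all_maxima = insert Top1 (insert Top2 (range infty))"
  by (auto simp: infty_def)

lemma maxima_nonempty: "maxima x \<noteq> {}"
  by (cases x) auto

lemma maxima_subset: "maxima x \<subseteq> all_maxima"
  by (cases x) auto

context pos_graph
begin

lemma le_maximal: "x \<in> all_maxima \<Longrightarrow> (x, y) \<in> pos_order G c \<longleftrightarrow> y = x"
  unfolding all_maxima_infty by auto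

lemma maximal_in_carrier: "x \<in> all_maxima \<Longrightarrow> x \<in> pos_carrier G"
  unfolding all_maxima_infty by auto

text \<open>Justifies the closed formula \<open>maxima\<close>, which avoids the order so that
  cardinalities of its values can be computed by simplification.\<close>

lemma in_maxima_iff:
  assumes "x \<in> pos_carrier G"
  shows "y \<in> maxima x \<longleftrightarrow> y \<in> all_maxima \<and> (x, y) \<in> pos_order G c"
  using assms unfolding all_maxima_infty
proof (cases rule: carrier_cases[where s' = True])
  case (Vert v)
  then show "y \<in> maxima x \<longleftrightarrow> y \<in> insert Top1 (insert Top2 (range infty)) \<and> (x, y) \<in> pos_order G c"
    using all_maxima_infty by (auto simp: le_Vert le_side)
qed (auto simp: le_side le_arc)

lemma le_trans:
  "(x, y) \<in> pos_order G c \<Longrightarrow> (y, z) \<in> pos_order G c \<Longrightarrow> (x, z) \<in> pos_order G c"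
  by (auto simp: pos_order_def)

end

subsection \<open>From homomorphisms to p-morphisms\<close>

text \<open>An edge keeps its copy if \<open>g\<close> sends its chosen endpoint to the chosen
  endpoint of the image edge; otherwise the copies are swapped. This makes \<open>lift\<close>
  respect orientations under arbitrary choices.\<close>

fun lift :: "('v set \<Rightarrow> 'v) \<Rightarrow> ('w set \<Rightarrow> 'w) \<Rightarrow> ('v \<Rightarrow> 'w) \<Rightarrow> 'v pos_elem \<Rightarrow> 'w pos_elem" where
  "lift c d g (Vert v) = Vert (g v)"
| "lift c d g (VertA v) = VertA (g v)"
| "lift c d g (VertB v) = VertB (g v)"
| "lift c d g (Edge1 e) = (if d (g ` e) = g (c e) then Edge1 (g ` e) else Edge2 (g ` e))"
| "lift c d g (Edge2 e) = (if d (g ` e) = g (c e) then Edge2 (g ` e) else Edge1 (g ` e))"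
| "lift c d g Top1 = Top1"
| "lift c d g Top2 = Top2"
| "lift c d g InfA = InfA"
| "lift c d g InfB = InfB"

lemma lift_simps [simp]:
  "lift c d g (side s v) = side s (g v)"
  "lift c d g (infty s) = infty s"
  by (auto simp: side_def infty_def)

locale pos_graph_pair = G: pos_graph G c + H: pos_graph H d
  for G :: "'v graph" and c and H :: "'w graph" and d
begin

text \<open>Since \<open>H\<close> has no loops, \<open>g u\<close> and \<open>g v\<close> differ,
  so \<open>c {u, v} = u\<close> can be tested after applying \<open>g\<close>. The swap in
  \<open>lift\<close> then compensates for differing choices.\<close>

lemma lift_arc:
  assumes "locally_surjective_hom G H g" and e: "{u, v} \<in> edges G"
  shows "lift c d g (arc c s u v) = arc d s (g u) (g v)"
proof -
  from assms have "{g u, g v} \<in> edges H"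
    by (auto simp: locally_surjective_hom_def)
  with G.edge_choice[OF e] G.edge_verts[OF e] H.edge_choice[of "g u" "g v"] H.edge_verts[of "g u" "g v"]
  show ?thesis
    by (auto simp: arc_def)
qed

lemma p_morphism_lift:
  assumes g: "locally_surjective_hom G H g"
  shows "p_morphism (pos_carrier G) (pos_order G c) (pos_carrier H) (pos_order H d) (lift c d g)"
  unfolding p_morphism_def
proof (intro conjI ballI impI)
  have verts: "g v \<in> verts H" if "v \<in> verts G" for v
    using g that by (auto simp: locally_surjective_hom_def)
  have edges: "{g u, g v} \<in> edges H" if "{u, v} \<in> edges G" for u v
    using g that by (auto simp: locally_surjective_hom_def)
  have lifts: "\<exists>v. {u, v} \<in> edges G \<and> g v = w" if "u \<in> verts G" "{g u, w} \<in> edges H" for u w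
    using g that H.edge_verts[of "g u" w] unfolding locally_surjective_hom_def by blast
  have carrier: "lift c d g x \<in> pos_carrier H" if "x \<in> pos_carrier G" for x
    using that
    by (cases rule: G.carrier_cases[where s' = True]) (auto simp: verts edges lift_arc[OF g])
  then show "lift c d g ` pos_carrier G \<subseteq> pos_carrier H" by auto
  have side_mono: "(side s (g v), lift c d g y) \<in> pos_order H d"
    if "v \<in> verts G" "(side s v, y) \<in> pos_order G c" for s v y
    using that edges[of v] by (fastforce simp: G.le_side H.le_side verts lift_arc[OF g])
  \<comment> \<open>Here local surjectivity enters: an arc above \<open>side s (g v)\<close> is an
    edge at \<open>g v\<close>, which lifts to an edge at \<open>v\<close>. The back condition at
    \<open>Vert v\<close> reduces to this one.\<close>
  have side_back: "\<exists>z\<in>pos_carrier G. (side s v, z) \<in> pos_order G c \<and> lift c d g z = y"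
    if v: "v \<in> verts G" and le: "(side s (g v), y) \<in> pos_order H d" for s v y
  proof -
    consider "y \<in> {side s (g v), infty s, Top1, Top2}"
      | w where "{g v, w} \<in> edges H" "y = arc d s (g v) w"
      using le H.le_side[OF verts[OF v]] by auto
    then show ?thesis
    proof cases
      case 1
      then consider "y = lift c d g (side s v)" | "y = lift c d g (infty s)"
        | "y = lift c d g Top1" | "y = lift c d g Top2" by auto
      then show ?thesis
        using v by cases (force simp: G.le_side)+
    next
      case 2
      with lifts[OF v] obtain u where u: "{v, u} \<in> edges G" "g u = w" by blast
      then show ?thesis
        using 2 v by (intro bexI[of _ "arc c s v u"]) (auto simp: G.le_side lift_arc[OF g])
    qed
  qed
  show "(lift c d g x, lift c d g y) \<in> pos_order H d"
    if x: "x \<in> pos_carrier G" and "y \<in> pos_carrier G" and le: "(x, y) \<in> pos_order G c" for x y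
    using x
  proof (cases rule: G.carrier_cases[where s' = True])
    case (Vert v)
    then show ?thesis
      using le side_mono by (auto simp: G.le_Vert H.le_Vert verts)
  next
    case (side s v)
    then show ?thesis
      using le side_mono by auto
  qed (use le in \<open>auto simp: G.le_arc H.le_arc edges lift_arc[OF g]\<close>)
  show "\<exists>z\<in>pos_carrier G. (x, z) \<in> pos_order G c \<and> lift c d g z = y"
    if x: "x \<in> pos_carrier G" and "y \<in> pos_carrier H" and le: "(lift c d g x, y) \<in> pos_order H d" for x y
    using x
  proof (cases rule: G.carrier_cases[where s' = True])
    case (Vert v)
    with le consider "y = Vert (g v)" | s where "(side s (g v), y) \<in> pos_order H d"
      by (auto simp: H.le_Vert verts)
    then show ?thesis
    proof cases
      case 1
      then show ?thesis using Vert by (intro bexI[of _ x]) (auto simp: G.le_Vert)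
    next
      case 2
      then show ?thesis using side_back[OF Vert(1) 2] Vert by (auto simp: G.le_Vert)
    qed
  next
    case (side s v)
    then show ?thesis
      using le side_back by auto
  next
    case (arc u v)
    with le have "y \<in> {lift c d g x, lift c d g Top1, lift c d g Top2}"
      by (auto simp: H.le_arc edges lift_arc[OF g])
    then show ?thesis
      using arc by (force simp: G.le_arc)
  qed (use le in auto)
qed

lemma lift_surj:
  assumes g: "locally_surjective_hom G H g" and surj: "g ` verts G = verts H"
  shows "lift c d g ` pos_carrier G = pos_carrier H"
proof
  show "lift c d g ` pos_carrier G \<subseteq> pos_carrier H"
    using p_morphism_lift[OF g] by (auto simp: p_morphism_def)
  have preimage: "\<exists>v\<in>verts G. g v = w" if "w \<in> verts H" for w
    using that surj[symmetric] by auto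
  show "pos_carrier H \<subseteq> lift c d g ` pos_carrier G"
  proof
    fix y assume "y \<in> pos_carrier H"
    then have "\<exists>x\<in>pos_carrier G. lift c d g x = y"
    proof (cases rule: H.carrier_cases[where s' = True])
      case (Vert w)
      with preimage obtain v where "v \<in> verts G" "g v = w" by blast
      with Vert show ?thesis by (intro bexI[of _ "Vert v"]) auto
    next
      case (side s w)
      with preimage obtain v where "v \<in> verts G" "g v = w" by blast
      with side show ?thesis by (intro bexI[of _ "side s v"]) auto
    next
      case (arc w w')
      \<comment> \<open>Surjectivity on vertices lifts the first endpoint; local surjectivity then
        lifts the edge itself.\<close>
      with preimage H.edge_verts[OF arc(1)] obtain v where v: "v \<in> verts G" "g v = w" by blast
      moreover have "\<forall>w\<in>verts H. {g v, w} \<in> edges H \<longrightarrow> (\<exists>u\<in>verts G. {v, u} \<in> edges G \<and> g u = w)"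
        using g v(1) by (simp add: locally_surjective_hom_def)
      ultimately obtain u where "{v, u} \<in> edges G" "g u = w'"
        using arc H.edge_verts[OF arc(1)] by blast
      with v arc show ?thesis
        by (intro bexI[of _ "arc c True v u"]) (auto simp: lift_arc[OF g])
    next
      case Top1
      then show ?thesis by (intro bexI[of _ Top1]) auto
    next
      case Top2
      then show ?thesis by (intro bexI[of _ Top2]) auto
    next
      case (infty s)
      then show ?thesis by (intro bexI[of _ "infty s"]) auto
    qed
    then show "y \<in> lift c d g ` pos_carrier G" by auto
  qed
qed

end

subsection \<open>From p-morphisms to homomorphisms\<close>

locale pos_morphism = pos_graph_pair G c H d
  for G :: "'v graph" and c and H :: "'w graph" and d +
  fixes h :: "'v pos_elem \<Rightarrow> 'w pos_elem"
  assumes p_morph: "p_morphism (pos_carrier G) (pos_order G c) (pos_carrier H) (pos_order H d) h"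
    and onto: "h ` pos_carrier G = pos_carrier H"
    and nonempty: "verts H \<noteq> {}"
begin

lemma h_carrier: "x \<in> pos_carrier G \<Longrightarrow> h x \<in> pos_carrier H"
  using onto by auto

lemma h_mono: "(x, y) \<in> pos_order G c \<Longrightarrow> (h x, h y) \<in> pos_order H d"
  using p_morph by (auto simp: p_morphism_def pos_order_def)

lemma h_back:
  assumes "x \<in> pos_carrier G" "(h x, y) \<in> pos_order H d"
  obtains z where "z \<in> pos_carrier G" "(x, z) \<in> pos_order G c" "h z = y"
proof -
  have "y \<in> pos_carrier H" using assms(2) by (simp add: pos_order_def)
  with p_morph assms that show ?thesis unfolding p_morphism_def by blast
qed

section \<open>Maximal elements under a surjective p-morphism\<close>

lemma h_maximal:
  assumes "m \<in> all_maxima"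
  shows "h m \<in> all_maxima"
proof -
  have m: "m \<in> pos_carrier G" using assms G.maximal_in_carrier by blast
  obtain y where y: "y \<in> maxima (h m)" using maxima_nonempty by blast
  then have "y \<in> all_maxima" "(h m, y) \<in> pos_order H d"
    using H.in_maxima_iff[OF h_carrier[OF m]] by auto
  \<comment> \<open>The back condition gives a preimage of \<open>y\<close> above \<open>m\<close>,
    and only \<open>m\<close> itself lies above \<open>m\<close>.\<close>
  moreover from this m assms have "h m = y"
    using G.le_maximal by (metis h_back)
  ultimately show ?thesis by simp
qed

lemma maxima_h:
  assumes x: "x \<in> pos_carrier G"
  shows "maxima (h x) = h ` maxima x"
proof
  show "h ` maxima x \<subseteq> maxima (h x)"
  proof
    fix y assume "y \<in> h ` maxima x"
    then obtain m where "m \<in> all_maxima" "(x, m) \<in> pos_order G c" "y = h m"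
      using G.in_maxima_iff[OF x] by auto
    then show "y \<in> maxima (h x)"
      using H.in_maxima_iff[OF h_carrier[OF x]] h_maximal h_mono by blast
  qed
  show "maxima (h x) \<subseteq> h ` maxima x"
  proof
    fix y assume "y \<in> maxima (h x)"
    then have y: "y \<in> all_maxima" "(h x, y) \<in> pos_order H d"
      using H.in_maxima_iff[OF h_carrier[OF x]] by auto
    obtain z where z: "z \<in> pos_carrier G" "(x, z) \<in> pos_order G c" "h z = y"
      using h_back[OF x y(2)] .
    \<comment> \<open>The preimage \<open>z\<close> need not be maximal. Moving up to a maximal
      \<open>m\<close> leaves the image unchanged, because \<open>h m\<close> lies above the maximal
      element \<open>y\<close>.\<close>
    obtain m where "m \<in> maxima z" using maxima_nonempty by blast
    then have m: "m \<in> all_maxima" "(z, m) \<in> pos_order G c"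
      using G.in_maxima_iff[OF z(1)] by auto
    from h_mono[OF m(2)] z(3) y(1) have "h m = y"
      using H.le_maximal by blast
    moreover have "m \<in> maxima x"
      using G.in_maxima_iff[OF x] m G.le_trans[OF z(2) m(2)] by blast
    ultimately show "y \<in> h ` maxima x" by blast
  qed
qed

text \<open>All four maximal elements lie above a vertex of \<open>H\<close>, so by
  \<open>maxima_h\<close> they are images of maximal elements above any preimage of that vertex. A
  map of a four-element set onto itself is injective. A vertex of \<open>H\<close> exists by
  \<open>nonempty\<close>.\<close>

lemma h_inj_maxima: "inj_on h all_maxima"
proof -
  obtain w where "w \<in> verts H" using nonempty by blast
  then have "Vert w \<in> h ` pos_carrier G" using onto by simp
  then obtain x where x: "x \<in> pos_carrier G" "h x = Vert w" by auto
  then have "h ` maxima x = all_maxima" using maxima_h[OF x(1)] by simp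
  then have "all_maxima \<subseteq> h ` all_maxima" using maxima_subset[of x] by blast
  moreover have "h ` all_maxima \<subseteq> all_maxima" using h_maximal by blast
  ultimately have "h ` all_maxima = all_maxima" by blast
  then show ?thesis
    by (intro eq_card_imp_inj_on) (simp_all only: finite.intros, simp)
qed

lemma card_maxima_h:
  assumes "x \<in> pos_carrier G"
  shows "card (maxima (h x)) = card (maxima x)"
  using maxima_h[OF assms] inj_on_subset[OF h_inj_maxima maxima_subset] by (simp add: card_image)

section \<open>Preservation of layers and the induced map on vertices\<close>

lemma h_eq_Vert:
  assumes "x \<in> pos_carrier G" "h x = Vert w"
  obtains v where "v \<in> verts G" "x = Vert v"
  using assms(1) card_maxima_h[OF assms(1)] assms(2) that
  by (cases rule: G.carrier_cases[where s' = True]) auto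

lemma h_Vert:
  assumes "v \<in> verts G"
  obtains w where "w \<in> verts H" "h (Vert v) = Vert w"
proof -
  have "h (Vert v) \<in> pos_carrier H" "card (maxima (h (Vert v))) = 4"
    using assms h_carrier card_maxima_h[of "Vert v"] by auto
  then show ?thesis
    using that by (cases rule: H.carrier_cases[where s' = True]) auto
qed

definition g :: "'v \<Rightarrow> 'w" where
  "g v = (THE w. h (Vert v) = Vert w)"

lemma h_Vert_g: "v \<in> verts G \<Longrightarrow> h (Vert v) = Vert (g v)"
  by (metis (mono_tags, lifting) g_def h_Vert pos_elem.inject(1) the_equality)

lemma g_verts: "v \<in> verts G \<Longrightarrow> g v \<in> verts H"
  by (metis h_Vert h_Vert_g pos_elem.inject(1))

lemma g_surj: "g ` verts G = verts H"
proof
  show "g ` verts G \<subseteq> verts H" using g_verts by auto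
  show "verts H \<subseteq> g ` verts G"
  proof
    fix w assume "w \<in> verts H"
    then have "Vert w \<in> h ` pos_carrier G" using onto by simp
    then obtain x where x: "x \<in> pos_carrier G" "h x = Vert w" by auto
    then show "w \<in> g ` verts G"
      by (metis h_Vert_g h_eq_Vert imageI pos_elem.inject(1))
  qed
qed

text \<open>A priori \<open>h\<close> could send \<open>infty s\<close> to a top, so the opposite
  infinity is tracked: it is the only maximal element not above \<open>side s v\<close>, hence goes
  to the only one not above the image. As it does not depend on \<open>v\<close>, neither will
  \<open>t\<close>.\<close>

lemma h_side_infty:
  assumes v: "v \<in> verts G"
  obtains t where "h (side s v) = side t (g v)" "h (infty (\<not> s)) = infty (\<not> t)"
proof -
  have x: "side s v \<in> pos_carrier G" using v by simp
  have "h (side s v) \<in> pos_carrier H" "card (maxima (h (side s v))) = 3"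
    using h_carrier[OF x] card_maxima_h[OF x] by auto
  then obtain t w where w: "w \<in> verts H" "h (side s v) = side t w"
    by (cases rule: H.carrier_cases[where s' = True]) auto
  have "(Vert v, side s v) \<in> pos_order G c"
    using v by (auto simp: G.le_Vert G.le_side)
  from h_mono[OF this] w v have "w = g v"
    by (auto simp: h_Vert_g H.le_Vert H.le_side g_verts)
  moreover have "h (infty (\<not> s)) = infty (\<not> t)"
  proof -
    have eq: "h ` {Top1, Top2, infty s} = {Top1, Top2, infty t}"
      using maxima_h[OF x] w by simp
    have "h (infty (\<not> s)) \<notin> h ` {Top1, Top2, infty s}"
      using h_inj_maxima by (auto simp: inj_on_def infty_def)
    moreover have "h (infty (\<not> s)) \<in> all_maxima"
      by (rule h_maximal) (auto simp: infty_def)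
    ultimately show ?thesis
      unfolding eq by (cases t) (auto simp: infty_def split: if_splits)
  qed
  ultimately show ?thesis using w that by blast
qed

text \<open>The side \<open>t\<close> is \<open>True\<close> if \<open>h\<close> preserves the indices \<open>a\<close> and \<open>b\<close>, and \<open>False\<close> if it
  exchanges them.\<close>

lemma h_side:
  obtains t where "\<And>s v. v \<in> verts G \<Longrightarrow> h (side s v) = side (s = t) (g v)"
proof -
  define t where "t \<longleftrightarrow> h (infty True) = infty True"
  have "h (side s v) = side (s = t) (g v)" if v: "v \<in> verts G" for s v
  proof -
    obtain p where p: "h (side True v) = side p (g v)" "h (infty False) = infty (\<not> p)"
      using h_side_infty[OF v, of True] by auto
    obtain q where q: "h (side False v) = side q (g v)" "h (infty True) = infty (\<not> q)"
      using h_side_infty[OF v, of False] by auto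
    \<comment> \<open>Injectivity forces \<open>p\<close> and \<open>q\<close> to differ, and
      \<open>q\<close> is determined by \<open>h (infty True)\<close>, that is, by
      \<open>t\<close>.\<close>
    have "h (infty True) \<noteq> h (infty False)"
      using h_inj_maxima by (auto simp: inj_on_def infty_def)
    with p q show ?thesis by (cases s) (auto simp: t_def)
  qed
  then show ?thesis using that by blast
qed

section \<open>Images of arcs and local surjectivity\<close>

lemma h_arc_is_arc:
  assumes "{u, v} \<in> edges G"
  obtains w w' where "{w, w'} \<in> edges H" "h (arc c s u v) = arc d s' w w'"
proof -
  have "h (arc c s u v) \<in> pos_carrier H" "card (maxima (h (arc c s u v))) = 2"
    using assms h_carrier card_maxima_h[of "arc c s u v"] by auto
  then show ?thesis
    using that by (cases rule: H.carrier_cases[where s' = s']) auto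
qed

text \<open>An arc is pinned down by the two sides below it. Monotonicity at \<open>u\<close> fixes
  the first endpoint of the image, and monotonicity at \<open>v\<close>, after flipping the arc,
  fixes the second.\<close>

lemma h_arc:
  assumes t: "\<And>s v. v \<in> verts G \<Longrightarrow> h (side s v) = side (s = t) (g v)"
    and e: "{u, v} \<in> edges G"
  shows "{g u, g v} \<in> edges H \<and> h (arc c s u v) = arc d (s = t) (g u) (g v)"
proof -
  have uv: "u \<in> verts G" "v \<in> verts G" using G.edge_verts[OF e] by auto
  \<comment> \<open>The image is written with side \<open>s = t\<close>, the side to which
    \<open>side s u\<close> is sent, so that \<open>arc_inject\<close> applies.\<close>
  obtain w w' where w: "{w, w'} \<in> edges H" "h (arc c s u v) = arc d (s = t) w w'"
    using h_arc_is_arc[OF e] .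
  have "(side s u, arc c s u v) \<in> pos_order G c"
    using e uv by (auto simp: G.le_side)
  from h_mono[OF this] have "w = g u"
    using w uv H.arc_inject by (fastforce simp: t H.le_side g_verts)
  have e': "{v, u} \<in> edges G" "{w', w} \<in> edges H" using e w by (auto simp: insert_commute)
  have "(side (\<not> s) v, arc c (\<not> s) v u) \<in> pos_order G c"
    using e' uv by (auto simp: G.le_side)
  from h_mono[OF this] have "(side ((\<not> s) = t) (g v), arc d (s = t) w w') \<in> pos_order H d"
    using w uv by (simp add: t G.arc_flip[OF e, symmetric])
  moreover have "arc d (s = t) w w' = arc d ((\<not> s) = t) w' w"
    using H.arc_flip[OF w(1), of "s = t"] by (cases s; cases t) auto
  ultimately have "w' = g v"
    using e' uv H.arc_inject by (fastforce simp: H.le_side g_verts)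
  with w \<open>w = g u\<close> show ?thesis by simp
qed

lemma g_locally_surjective: "locally_surjective_hom G H g"
  unfolding locally_surjective_hom_def
proof (intro conjI allI ballI impI)
  obtain t where t: "\<And>s v. v \<in> verts G \<Longrightarrow> h (side s v) = side (s = t) (g v)"
    using h_side by blast
  show "g ` verts G \<subseteq> verts H" using g_verts by auto
  show "{g u, g v} \<in> edges H" if "{u, v} \<in> edges G" for u v
    using h_arc[OF t that] by blast
  show "\<exists>v\<in>verts G. {u, v} \<in> edges G \<and> g v = w"
    if u: "u \<in> verts G" and w: "w \<in> verts H" and e: "{g u, w} \<in> edges H" for u w
  proof -
    \<comment> \<open>Starting from \<open>side t u\<close> makes the image
      \<open>side True (g u)\<close> whether or not \<open>h\<close> exchanges the indices.\<close>
    have "(h (side t u), arc d True (g u) w) \<in> pos_order H d"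
      using u e by (auto simp: t H.le_side g_verts)
    then obtain z where z: "z \<in> pos_carrier G" "(side t u, z) \<in> pos_order G c"
      "h z = arc d True (g u) w"
      using h_back[of "side t u"] u by auto
    \<comment> \<open>Among the elements above \<open>side t u\<close>, the count 2 leaves only
      arcs: the side itself has 3, tops and infinities have 1.\<close>
    have card: "card (maxima z) = 2" using card_maxima_h[OF z(1)] z(3) by simp
    from z(2) u obtain v where v: "{u, v} \<in> edges G" "z = arc c t u v"
      using card by (auto simp: G.le_side)
    have "arc d True (g u) w = arc d True (g u) (g v)"
      using h_arc[OF t v(1), of t] z(3) v(2) by simp
    then have "g v = w" using H.arc_inject e by blast
    then show ?thesis using v G.edge_verts by blast
  qed
qed

end

theorem theorem4:
  fixes G :: "'v graph" and H :: "'w graph"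
    and c :: "'v set \<Rightarrow> 'v" and d :: "'w set \<Rightarrow> 'w"
  assumes "simple_graph G" and "simple_graph H"
    and "verts H \<noteq> {}"
    and "endpoint_choice G c" and "endpoint_choice H d"
  shows "(\<exists>g. locally_surjective_hom G H g \<and> g ` verts G = verts H) \<longleftrightarrow>
         (\<exists>h. p_morphism (pos_carrier G) (pos_order G c) (pos_carrier H) (pos_order H d) h \<and>
              h ` pos_carrier G = pos_carrier H)"
proof -
  interpret pos_graph_pair G c H d
    using assms by unfold_locales
  show ?thesis
  proof (intro iffI; elim exE conjE)
    fix g assume "locally_surjective_hom G H g" "g ` verts G = verts H"
    then show "\<exists>h. p_morphism (pos_carrier G) (pos_order G c) (pos_carrier H) (pos_order H d) h \<and>
        h ` pos_carrier G = pos_carrier H"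
      using p_morphism_lift lift_surj by blast
  next
    fix h assume "p_morphism (pos_carrier G) (pos_order G c) (pos_carrier H) (pos_order H d) h"
      "h ` pos_carrier G = pos_carrier H"
    then interpret pos_morphism G c H d h
      using assms by unfold_locales
    show "\<exists>g. locally_surjective_hom G H g \<and> g ` verts G = verts H"
      using g_locally_surjective g_surj by blast
  qed
qed

end
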